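(* Let $(b,c)$ be a connected graph over the countably infinite set $X$. Then the following assertions are equivalent: (i) The graph $(b,c)$ is canonically compactifiable. (ii) The graph $(b,c)$ is uniformly transient and every harmonic function of finite energy is bounded.
   Context: $X$ is a countably infinite set, $C(X)$ the real-valued functions on $X$, $C_c(X)$ those with finite support, $\ell^\infty(X)$ the bounded ones, $\|f\|_\infty=\sup_X|f|$, and $C_0(X)$ is the closure of $C_c(X)$ with respect to $\|\cdot\|_\infty$. A graph $(b,c)$ over $X$ consists of a symmetric $b:X\times X\to[0,\infty)$ with zero diagonal and $\sum_{y}b(x,y)<\infty$ for all $x$, and an arbitrary $c:X\to[0,\infty)$. It is connected if for any two distinct $x,y\in X$ there are $x=x_0,\dots,x_n=y$ with $b(x_{i-1},x_i)>0$ for $i=1,\dots,n$. For $f\in C(X)$ put $\widetilde Q(f)=\frac12\sum_{x,y}b(x,y)|f(x)-f(y)|^2+\sum_x c(x)|f(x)|^2\in[0,\infty]$ and $\widetilde D=\{f\in C(X):\widetilde Q(f)<\infty\}$; functions in $\widetilde D$ are said to have finite energy. For $o\in X$ put $\|f\|_o=(\widetilde Q(f)+|f(o)|^2)^{1/2}$; $\widetilde D_0$ is the closure of $C_c(X)$ in $\widetilde D$ with respect to $\|\cdot\|_o$ (independent of $o$ for connected graphs). A connected graph is uniformly transient if $\widetilde D_0\subseteq C_0(X)$, and canonically compactifiable if $\widetilde D\subseteq\ell^\infty(X)$. A function $f$ with $\sum_y b(x,y)|f(y)|<\infty$ for all $x$ is harmonic if $\mathcal Lf(x):=\sum_y b(x,y)(f(x)-f(y))+c(x)f(x)=0$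 for all $x\in X$ (all functions in $\widetilde D$ satisfy the summability condition). *)

theory Defs
  imports "HOL-Analysis.Analysis"
begin

text \<open>The set \<open>X\<close> is the universe of the type \<open>'a\<close>; functions on \<open>X\<close> are functions \<open>'a \<Rightarrow> real\<close>.\<close>

definition weighted_graph :: "('a \<Rightarrow> 'a \<Rightarrow> real) \<Rightarrow> ('a \<Rightarrow> real) \<Rightarrow> bool" where
  "weighted_graph b c \<longleftrightarrow>
     (\<forall>x y. 0 \<le> b x y) \<and> (\<forall>x y. b x y = b y x) \<and> (\<forall>x. b x x = 0) \<and>
     (\<forall>x. (\<lambda>y. b x y) summable_on UNIV) \<and> (\<forall>x. 0 \<le> c x)"

definition connected_graph :: "('a \<Rightarrow> 'a \<Rightarrow> real) \<Rightarrow> bool" where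
  "connected_graph b \<longleftrightarrow>
     (\<forall>x y. x \<noteq> y \<longrightarrow>
        (\<exists>(n::nat) p. p 0 = x \<and> p n = y \<and> (\<forall>i\<in>{1..n}. b (p (i - 1)) (p i) > 0)))"

definition Cc :: "('a \<Rightarrow> real) set" where
  "Cc = {f. finite {x. f x \<noteq> 0}}"

definition sup_norm :: "('a \<Rightarrow> real) \<Rightarrow> ennreal" where
  "sup_norm f = (SUP x. ennreal \<bar>f x\<bar>)"

definition linfty :: "('a \<Rightarrow> real) set" where
  "linfty = {f. bounded (range f)}"

text \<open>The closure is spelled out, since \<^const>\<open>closure\<close> on a function type refers to the product
  topology.\<close>

definition C0 :: "('a \<Rightarrow> real) set" where
  "C0 = {f. \<forall>e>0. \<exists>\<phi>\<in>Cc. sup_norm (\<lambda>x. f x - \<phi> x) < ennreal e}"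

text \<open>Sums of nonnegative terms are taken in \<^typ>\<open>ennreal\<close>, where every family is summable.\<close>

definition energy :: "('a \<Rightarrow> 'a \<Rightarrow> real) \<Rightarrow> ('a \<Rightarrow> real) \<Rightarrow> ('a \<Rightarrow> real) \<Rightarrow> ennreal" where
  "energy b c f =
     1 / 2 * (\<Sum>\<^sub>\<infinity>(x, y)\<in>UNIV. ennreal (b x y * \<bar>f x - f y\<bar>\<^sup>2)) +
     (\<Sum>\<^sub>\<infinity>x\<in>UNIV. ennreal (c x * \<bar>f x\<bar>\<^sup>2))"

definition finite_energy :: "('a \<Rightarrow> 'a \<Rightarrow> real) \<Rightarrow> ('a \<Rightarrow> real) \<Rightarrow> ('a \<Rightarrow> real) set" where
  "finite_energy b c = {f. energy b c f < \<infinity>}"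

text \<open>Only meaningful for functions of finite energy, as \<^const>\<open>enn2real\<close> maps \<open>\<infinity>\<close> to \<open>0\<close>. In
  the closure below it is applied to such functions only: for a weighted graph, \<open>finite_energy b c\<close>
  contains \<^const>\<open>Cc\<close> and is closed under differences (proved at the end of this theory).\<close>

definition energy_norm ::
  "('a \<Rightarrow> 'a \<Rightarrow> real) \<Rightarrow> ('a \<Rightarrow> real) \<Rightarrow> 'a \<Rightarrow> ('a \<Rightarrow> real) \<Rightarrow> real" where
  "energy_norm b c z f = sqrt (enn2real (energy b c f) + \<bar>f z\<bar>\<^sup>2)"

definition finite_energy0 ::
  "('a \<Rightarrow> 'a \<Rightarrow> real) \<Rightarrow> ('a \<Rightarrow> real) \<Rightarrow> 'a \<Rightarrow> ('a \<Rightarrow> real) set" where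
  "finite_energy0 b c z =
     {f \<in> finite_energy b c. \<forall>e>0. \<exists>\<phi>\<in>Cc. energy_norm b c z (\<lambda>x. f x - \<phi> x) < e}"

text \<open>The reference vertex \<open>z\<close> is kept as a parameter; for connected graphs the notion does not
  depend on it.\<close>

definition uniformly_transient ::
  "('a \<Rightarrow> 'a \<Rightarrow> real) \<Rightarrow> ('a \<Rightarrow> real) \<Rightarrow> 'a \<Rightarrow> bool" where
  "uniformly_transient b c z \<longleftrightarrow> finite_energy0 b c z \<subseteq> C0"

definition canonically_compactifiable ::
  "('a \<Rightarrow> 'a \<Rightarrow> real) \<Rightarrow> ('a \<Rightarrow> real) \<Rightarrow> bool" where
  "canonically_compactifiable b c \<longleftrightarrow> finite_energy b c \<subseteq> linfty"

definition graph_laplacian ::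
  "('a \<Rightarrow> 'a \<Rightarrow> real) \<Rightarrow> ('a \<Rightarrow> real) \<Rightarrow> ('a \<Rightarrow> real) \<Rightarrow> 'a \<Rightarrow> real" where
  "graph_laplacian b c f x = (\<Sum>\<^sub>\<infinity>y\<in>UNIV. b x y * (f x - f y)) + c x * f x"

definition graph_harmonic ::
  "('a \<Rightarrow> 'a \<Rightarrow> real) \<Rightarrow> ('a \<Rightarrow> real) \<Rightarrow> ('a \<Rightarrow> real) \<Rightarrow> bool" where
  "graph_harmonic b c f \<longleftrightarrow>
     (\<forall>x. (\<lambda>y. b x y * \<bar>f y\<bar>) summable_on UNIV) \<and> (\<forall>x. graph_laplacian b c f x = 0)"

lemma infsum_ennreal_finite_iff:
  fixes g :: "'i \<Rightarrow> real"
  assumes "\<And>x. x \<in> A \<Longrightarrow> 0 \<le> g x"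
  shows "(\<Sum>\<^sub>\<infinity>x\<in>A. ennreal (g x)) < \<infinity> \<longleftrightarrow> g summable_on A"
proof -
  have S: "(\<Sum>\<^sub>\<infinity>x\<in>A. ennreal (g x)) = (SUP F\<in>{F. finite F \<and> F \<subseteq> A}. \<Sum>x\<in>F. ennreal (g x))"
    by (rule nonneg_infsum_complete) simp
  have E: "(\<Sum>x\<in>F. ennreal (g x)) = ennreal (sum g F)" if "F \<subseteq> A" for F
    using assms that by (intro sum_ennreal) auto
  show ?thesis
  proof
    assume fin: "(\<Sum>\<^sub>\<infinity>x\<in>A. ennreal (g x)) < \<infinity>"
    then obtain B where B: "(\<Sum>\<^sub>\<infinity>x\<in>A. ennreal (g x)) = ennreal B" "0 \<le> B"
      by (cases "\<Sum>\<^sub>\<infinity>x\<in>A. ennreal (g x)") auto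
    have "sum g F \<le> B" if "finite F" "F \<subseteq> A" for F
    proof -
      have "ennreal (sum g F) \<le> ennreal B"
        unfolding B(1)[symmetric] S E[OF that(2), symmetric]
        using that by (intro SUP_upper) auto
      then show ?thesis using B(2) by (simp add: ennreal_le_iff)
    qed
    then show "g summable_on A"
      using assms by (intro nonneg_bdd_above_summable_on bdd_aboveI[of _ B]) auto
  next
    assume sm: "g summable_on A"
    have "(\<Sum>\<^sub>\<infinity>x\<in>A. ennreal (g x)) \<le> ennreal (infsum g A)"
      unfolding S
    proof (rule SUP_least)
      fix F assume F: "F \<in> {F. finite F \<and> F \<subseteq> A}"
      then have "sum g F \<le> infsum g A"
        using assms by (intro finite_sum_le_infsum sm) auto
      then show "(\<Sum>x\<in>F. ennreal (g x)) \<le> ennreal (infsum g A)"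
        using F E[of F] by (simp add: ennreal_leI)
    qed
    then show "(\<Sum>\<^sub>\<infinity>x\<in>A. ennreal (g x)) < \<infinity>"
      by (metis ennreal_less_top infinity_ennreal_def le_less_trans)
  qed
qed

lemma finite_energy_iff:
  assumes "weighted_graph b c"
  shows "f \<in> finite_energy b c \<longleftrightarrow>
    (\<lambda>(x, y). b x y * \<bar>f x - f y\<bar>\<^sup>2) summable_on UNIV \<and> (\<lambda>x. c x * \<bar>f x\<bar>\<^sup>2) summable_on UNIV"
proof -
  have nn: "0 \<le> b x y" "0 \<le> c x" for x y
    using assms by (auto simp: weighted_graph_def)
  have half: "1 / 2 * t < \<infinity> \<longleftrightarrow> t < (\<infinity>::ennreal)" for t
    using ennreal_divide_eq_top_iff[of 1 2]
    by (simp add: less_top[symmetric] ennreal_mult_eq_top_iff)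
  have "(\<lambda>(x, y). ennreal (b x y * \<bar>f x - f y\<bar>\<^sup>2)) = (\<lambda>p. ennreal ((\<lambda>(x, y). b x y * \<bar>f x - f y\<bar>\<^sup>2) p))"
    by auto
  then show ?thesis
    using infsum_ennreal_finite_iff[of UNIV "\<lambda>(x, y). b x y * \<bar>f x - f y\<bar>\<^sup>2"]
      infsum_ennreal_finite_iff[of UNIV "\<lambda>x. c x * \<bar>f x\<bar>\<^sup>2"] nn half
    by (auto simp: finite_energy_def energy_def)
qed

lemma finite_energy_diff:
  assumes "weighted_graph b c" "f \<in> finite_energy b c" "g \<in> finite_energy b c"
  shows "(\<lambda>x. f x - g x) \<in> finite_energy b c"
proof -
  have nn: "0 \<le> b x y" "0 \<le> c x" for x y
    using assms by (auto simp: weighted_graph_def)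
  have sq: "w * \<bar>s - t\<bar>\<^sup>2 \<le> 2 * (w * \<bar>s\<bar>\<^sup>2) + 2 * (w * \<bar>t\<bar>\<^sup>2)" if "0 \<le> w" for w s t :: real
  proof -
    have "(s - t)\<^sup>2 \<le> 2 * s\<^sup>2 + 2 * t\<^sup>2"
      using zero_le_power2[of "s + t"] by (simp add: power2_eq_square algebra_simps)
    from mult_left_mono[OF this that] show ?thesis by (simp add: algebra_simps)
  qed
  note F = assms(2)[unfolded finite_energy_iff[OF assms(1)]]
    and G = assms(3)[unfolded finite_energy_iff[OF assms(1)]]
  have "(\<lambda>(x, y). b x y * \<bar>(f x - g x) - (f y - g y)\<bar>\<^sup>2) summable_on UNIV"
  proof (rule summable_on_comparison_test)
    show "(\<lambda>p. 2 * (case p of (x, y) \<Rightarrow> b x y * \<bar>f x - f y\<bar>\<^sup>2) +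
        2 * (case p of (x, y) \<Rightarrow> b x y * \<bar>g x - g y\<bar>\<^sup>2)) summable_on UNIV"
      using F G by (intro summable_on_add summable_on_cmult_right) auto
    show "(case p of (x, y) \<Rightarrow> b x y * \<bar>(f x - g x) - (f y - g y)\<bar>\<^sup>2) \<le>
        2 * (case p of (x, y) \<Rightarrow> b x y * \<bar>f x - f y\<bar>\<^sup>2) +
        2 * (case p of (x, y) \<Rightarrow> b x y * \<bar>g x - g y\<bar>\<^sup>2)" for p
    proof (cases p)
      case (Pair x y)
      have "(f x - g x) - (f y - g y) = (f x - f y) - (g x - g y)" by simp
      then show ?thesis
        unfolding Pair prod.case using sq[OF nn(1), of x y "f x - f y" "g x - g y"] by presburger
    qed
  qed (use nn in auto)
  moreover have "(\<lambda>x. c x * \<bar>f x - g x\<bar>\<^sup>2) summable_on UNIV"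
  proof (rule summable_on_comparison_test)
    show "(\<lambda>x. 2 * (c x * \<bar>f x\<bar>\<^sup>2) + 2 * (c x * \<bar>g x\<bar>\<^sup>2)) summable_on UNIV"
      using F G by (intro summable_on_add summable_on_cmult_right) auto
  qed (use nn sq in auto)
  ultimately show ?thesis
    by (simp add: finite_energy_iff[OF assms(1)])
qed

lemma Cc_subset_finite_energy:
  assumes "weighted_graph b c"
  shows "Cc \<subseteq> finite_energy b c"
proof
  fix f :: "'a \<Rightarrow> real"
  assume "f \<in> Cc"
  define S where "S = {x. f x \<noteq> 0}"
  have S: "finite S" using \<open>f \<in> Cc\<close> by (simp add: S_def Cc_def)
  have nn: "0 \<le> b x y" "0 \<le> c x" "b x y = b y x" "b x summable_on UNIV" for x y
    using assms by (auto simp: weighted_graph_def)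
  have 1: "(\<lambda>(x, y). b x y * (f x)\<^sup>2) summable_on S \<times> UNIV"
  proof (rule summable_on_SigmaI)
    show "((\<lambda>y. case (x, y) of (x, y) \<Rightarrow> b x y * (f x)\<^sup>2) has_sum infsum (b x) UNIV * (f x)\<^sup>2) UNIV" for x
      using nn(4)[of x] by (auto intro!: has_sum_cmult_left)
    show "(\<lambda>x. infsum (b x) UNIV * (f x)\<^sup>2) summable_on S"
      using S by simp
  qed (use nn in auto)
  have P1: "(\<lambda>(x, y). b x y * (f x)\<^sup>2) summable_on UNIV"
    by (rule summable_on_cong_neutral[THEN iffD1, OF _ _ _ 1]) (auto simp: S_def)
  have P2: "(\<lambda>(x, y). b x y * (f y)\<^sup>2) summable_on UNIV"
  proof -
    have "(\<lambda>(x, y). b y x * (f y)\<^sup>2) summable_on UNIV \<times> UNIV"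
      using P1 by (subst summable_on_swap) (simp add: case_prod_unfold)
    then show ?thesis using nn(3) by (simp add: case_prod_unfold)
  qed
  have "(\<lambda>(x, y). b x y * \<bar>f x - f y\<bar>\<^sup>2) summable_on UNIV"
  proof (rule summable_on_comparison_test)
    show "(\<lambda>p. 2 * (case p of (x, y) \<Rightarrow> b x y * (f x)\<^sup>2) +
        2 * (case p of (x, y) \<Rightarrow> b x y * (f y)\<^sup>2)) summable_on UNIV"
      using P1 P2 by (intro summable_on_add summable_on_cmult_right)
    show "(case p of (x, y) \<Rightarrow> b x y * \<bar>f x - f y\<bar>\<^sup>2) \<le>
        2 * (case p of (x, y) \<Rightarrow> b x y * (f x)\<^sup>2) + 2 * (case p of (x, y) \<Rightarrow> b x y * (f y)\<^sup>2)" for p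
    proof (cases p)
      case (Pair x y)
      have "(f x - f y)\<^sup>2 \<le> 2 * (f x)\<^sup>2 + 2 * (f y)\<^sup>2"
        using zero_le_power2[of "f x + f y"] by (simp add: power2_eq_square algebra_simps)
      from mult_left_mono[OF this nn(1)[of x y]] show ?thesis
        by (simp add: Pair algebra_simps)
    qed
  qed (use nn in auto)
  moreover have "(\<lambda>x. c x * \<bar>f x\<bar>\<^sup>2) summable_on UNIV"
    by (rule summable_on_cong_neutral[THEN iffD1, OF _ _ _ summable_on_finite[OF S]])
      (auto simp: S_def)
  ultimately show "f \<in> finite_energy b c"
    by (simp add: finite_energy_iff[OF assms])
qed

end

theory Submission
  imports Defs
begin

text \<open>
  If all functions of finite energy are bounded, then the supremum norm is dominated by the energy
  norm (otherwise the supremum of suitably rescaled functions would have finite energy and be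
  unbounded), so limits of finitely supported functions in the energy norm are uniform limits.
  Conversely, uniform transience excludes that the constant function \<open>1\<close> is a limit of finitely
  supported functions, which makes the energy itself control point evaluations on \<^const>\<open>Cc\<close>.
  Hence every function of finite energy splits into its projection to the closure of \<^const>\<open>Cc\<close>,
  which is bounded by uniform transience, and a remainder of minimal energy, which is harmonic.
\<close>

section \<open>Elementary inequalities and unconditional sums\<close>

text \<open>Expands \<open>(e * s - t)^2 \<ge> 0\<close>. Keeping \<open>e\<close> free leaves the
  coefficient of \<open>s^2\<close> as close to 1 as desired, so that an error \<open>t\<close> can
  vanish in a limit before \<open>e\<close> tends to 0.\<close>

lemma weighted_square_add_le:
  fixes s t e :: real
  assumes "0 < e"
  shows "(s + t)\<^sup>2 \<le> (1 + e) * s\<^sup>2 + (1 + 1 / e) * t\<^sup>2"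
proof -
  have "0 \<le> (e * s - t)\<^sup>2 / e" using assms by simp
  also have "\<dots> = e * s\<^sup>2 + t\<^sup>2 / e - 2 * s * t"
    using assms by (simp add: power2_eq_square field_simps)
  finally show ?thesis by (simp add: power2_eq_square algebra_simps)
qed

text \<open>Taking maxima is nonexpansive for the maximum norm on pairs, and the larger of two
  squares is at most their sum. This is the termwise form of the energy bound for maxima.\<close>

lemma max_diff_power2_le:
  fixes s t u v :: real
  shows "(max s t - max u v)\<^sup>2 \<le> (s - u)\<^sup>2 + (t - v)\<^sup>2"
proof -
  have "\<bar>max s t - max u v\<bar> \<le> \<bar>s - u\<bar> \<or> \<bar>max s t - max u v\<bar> \<le> \<bar>t - v\<bar>"
    by (auto simp: max_def)
  then have "(max s t - max u v)\<^sup>2 \<le> (s - u)\<^sup>2 \<or> (max s t - max u v)\<^sup>2 \<le> (t - v)\<^sup>2"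
    by (simp add: abs_le_square_iff)
  then show ?thesis
    by (smt (verit) zero_le_power2)
qed

text \<open>First-variation principle: for small \<open>t\<close> of sign opposite to
  \<open>B\<close> the linear term outweighs the quadratic one.\<close>

lemma linear_coeff_zero_of_quadratic_nonneg:
  fixes B K :: real
  assumes "\<And>t. 0 \<le> 2 * t * B + t\<^sup>2 * K"
  shows "B = 0"
proof (rule ccontr)
  assume "B \<noteq> 0"
  \<comment> \<open>Any positive \<open>L\<close> with \<open>K < 2 * L\<close> would do: at
    \<open>t = - B / L\<close> the polynomial equals \<open>(B / L)^2 * (K - 2 * L)\<close>, which
    is negative.\<close>
  define L where "L = \<bar>K\<bar> + 1"
  have L: "0 < L" "K < 2 * L" by (auto simp: L_def)
  have "0 \<le> 2 * (- B / L) * B + (- B / L)\<^sup>2 * K" by (rule assms)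
  also have "\<dots> = (B / L)\<^sup>2 * (K - 2 * L)"
    using L by (simp add: power2_eq_square field_simps)
  finally have "0 \<le> K - 2 * L"
    using \<open>B \<noteq> 0\<close> L by (simp add: zero_le_mult_iff)
  with L show False by simp
qed

lemma ennreal_infsum:
  fixes g :: "'i \<Rightarrow> real"
  assumes "g summable_on A" "\<And>x. x \<in> A \<Longrightarrow> 0 \<le> g x"
  shows "(\<Sum>\<^sub>\<infinity>x\<in>A. ennreal (g x)) = ennreal (infsum g A)"
proof -
  have "(\<Sum>\<^sub>\<infinity>x\<in>A. ennreal (g x)) = (SUP F\<in>{F. finite F \<and> F \<subseteq> A}. \<Sum>x\<in>F. ennreal (g x))"
    by (rule nonneg_infsum_complete) simp
  also have "\<dots> = (SUP F\<in>{F. finite F \<and> F \<subseteq> A}. ennreal (sum g F))"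
    using assms(2) by (intro SUP_cong refl sum_ennreal) auto
  also have "\<dots> = ennreal (infsum g A)"
    using infsum_nonneg_is_SUPREMUM_ennreal[OF assms] by simp
  finally show ?thesis .
qed

lemma has_sum_sum_type:
  fixes g :: "'i + 'j \<Rightarrow> real"
  assumes "((\<lambda>p. g (Inl p)) has_sum s) UNIV" "((\<lambda>p. g (Inr p)) has_sum t) UNIV"
  shows "(g has_sum (s + t)) UNIV"
proof -
  have "(g has_sum s) (range Inl)" "(g has_sum t) (range Inr)"
    using assms by (simp_all add: has_sum_reindex o_def)
  then have "(g has_sum (s + t)) (range Inl \<union> range Inr)"
    by (rule has_sum_Un_disjoint) auto
  then show ?thesis by (simp add: UNIV_sum)
qed

section \<open>Supremum norm, bounded functions and finite support\<close>

lemma sup_norm_lessD: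
  assumes "sup_norm f < ennreal e"
  shows "\<bar>f x\<bar> < e"
proof -
  have "ennreal \<bar>f x\<bar> \<le> sup_norm f"
    unfolding sup_norm_def by (rule SUP_upper) simp
  with assms have "ennreal \<bar>f x\<bar> < ennreal e" by (rule le_less_trans[rotated])
  then show ?thesis by (simp add: ennreal_less_iff)
qed

lemma sup_norm_le:
  assumes "\<And>x. \<bar>f x\<bar> \<le> e"
  shows "sup_norm f \<le> ennreal e"
  unfolding sup_norm_def using assms by (intro SUP_least ennreal_leI)

lemma linftyI: "(\<And>x. \<bar>f x\<bar> \<le> B) \<Longrightarrow> f \<in> linfty"
  unfolding linfty_def by (auto simp: bounded_iff)

lemma linftyE:
  assumes "f \<in> linfty"
  obtains B where "\<And>x. \<bar>f x\<bar> \<le> B"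
  using assms unfolding linfty_def by (auto simp: bounded_iff)

lemma linfty_add:
  assumes "f \<in> linfty" "g \<in> linfty"
  shows "(\<lambda>x. f x + g x) \<in> linfty"
proof -
  obtain A B where "\<And>x. \<bar>f x\<bar> \<le> A" "\<And>x. \<bar>g x\<bar> \<le> B"
    using assms by (metis linftyE)
  then have "\<bar>f x + g x\<bar> \<le> A + B" for x
    using abs_triangle_ineq[of "f x" "g x"] by (meson add_mono order_trans)
  then show ?thesis by (rule linftyI)
qed

text \<open>A member of \<open>C0\<close> lies within distance 1 of a finitely supported function,
  whose range is finite.\<close>

lemma C0_subset_linfty: "C0 \<subseteq> linfty"
proof
  fix f :: "'a \<Rightarrow> real"
  assume "f \<in> C0"
  then obtain \<phi> where \<phi>: "\<phi> \<in> Cc" "sup_norm (\<lambda>x. f x - \<phi> x) < ennreal 1"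
    unfolding C0_def using zero_less_one by blast
  have "finite (insert 0 (\<phi> ` {x. \<phi> x \<noteq> 0}))"
    using \<phi>(1) by (simp add: Cc_def)
  then have "finite (range \<phi>)"
    by (rule rev_finite_subset) auto
  then have "\<phi> \<in> linfty"
    unfolding linfty_def by (simp add: finite_imp_bounded)
  moreover have "(\<lambda>x. f x - \<phi> x) \<in> linfty"
    using sup_norm_lessD[OF \<phi>(2)] by (intro linftyI[of _ 1] less_imp_le)
  ultimately show "f \<in> linfty"
    using linfty_add by fastforce
qed

text \<open>A function at distance less than 1 from the constant 1 vanishes nowhere, so its support
  is the whole infinite set.\<close>

lemma one_notin_C0:
  assumes "infinite (UNIV :: 'a set)"
  shows "(\<lambda>_ :: 'a. 1) \<notin> C0"
proof
  assume "(\<lambda>_ :: 'a. 1) \<in> C0"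
  then obtain \<phi> :: "'a \<Rightarrow> real" where \<phi>: "\<phi> \<in> Cc" "sup_norm (\<lambda>x. 1 - \<phi> x) < ennreal 1"
    unfolding C0_def using zero_less_one by blast
  have "\<phi> x \<noteq> 0" for x
    using sup_norm_lessD[OF \<phi>(2), of x] by auto
  then show False
    using \<phi>(1) assms by (simp add: Cc_def)
qed

lemma indicator_Cc: "indicat_real {x} \<in> Cc"
  by (simp add: Cc_def indicator_def)

lemma Cc_cmult: "f \<in> Cc \<Longrightarrow> (\<lambda>x. t * f x) \<in> Cc"
  by (simp add: Cc_def)

lemma Cc_add: "f \<in> Cc \<Longrightarrow> g \<in> Cc \<Longrightarrow> (\<lambda>x. f x + g x) \<in> Cc"
  unfolding Cc_def mem_Collect_eq by (rule finite_subset[of _ "{x. f x \<noteq> 0} \<union> {x. g x \<noteq> 0}"]) auto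

section \<open>The energy as the squared norm of a discrete gradient\<close>

locale weighted =
  fixes b :: "'a \<Rightarrow> 'a \<Rightarrow> real" and c :: "'a \<Rightarrow> real"
  assumes weighted: "weighted_graph b c"
begin

lemma b_nonneg: "0 \<le> b x y" and b_sym: "b x y = b y x"
  and b_summable: "b x summable_on UNIV" and c_nonneg: "0 \<le> c x"
  using weighted by (auto simp: weighted_graph_def)

text \<open>The energy is the squared \<open>\<ell>\<^sup>2\<close> norm of \<open>grad f\<close>, the factor \<open>1 / 2\<close> being absorbed into
  the edge weights. As \<open>grad\<close> is linear, inequalities for the energy can be checked termwise.\<close>

definition grad :: "('a \<Rightarrow> real) \<Rightarrow> ('a \<times> 'a) + 'a \<Rightarrow> real" where
  "grad f i = (case i of Inl (x, y) \<Rightarrow> sqrt (b x y / 2) * (f x - f y) | Inr x \<Rightarrow> sqrt (c x) * f x)"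

abbreviation FE :: "('a \<Rightarrow> real) set" where
  "FE \<equiv> finite_energy b c"

text \<open>A real-valued energy, convenient for arithmetic. As \<open>infsum\<close> is 0 on
  families that are not summable, \<open>Q\<close> is 0 outside \<open>FE\<close>, where the energy
  is infinite; energy estimates therefore carry membership in \<open>FE\<close>.\<close>

definition Q :: "('a \<Rightarrow> real) \<Rightarrow> real" where
  "Q f = (\<Sum>\<^sub>\<infinity>i\<in>UNIV. (grad f i)\<^sup>2)"

lemma grad_Inl [simp]: "grad f (Inl (x, y)) = sqrt (b x y / 2) * (f x - f y)"
  and grad_Inr [simp]: "grad f (Inr x) = sqrt (c x) * f x"
  by (simp_all add: grad_def)

lemma grad_cases:
  obtains x y where "i = Inl (x, y)" | x where "i = Inr x"
  by (cases i) auto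

lemma grad_add: "grad (\<lambda>x. f x + g x) i = grad f i + grad g i"
  by (cases i rule: grad_cases) (simp_all add: algebra_simps)

lemma grad_diff: "grad (\<lambda>x. f x - g x) i = grad f i - grad g i"
  by (cases i rule: grad_cases) (simp_all add: algebra_simps)

lemma grad_cmult: "grad (\<lambda>x. t * f x) i = t * grad f i"
  by (cases i rule: grad_cases) (simp_all add: algebra_simps)

lemma FE_iff: "f \<in> FE \<longleftrightarrow> (\<lambda>i. (grad f i)\<^sup>2) summable_on UNIV"
proof -
  have *: "(\<lambda>p. (grad f (Inl p))\<^sup>2) = (\<lambda>p. (1/2) * (case p of (x, y) \<Rightarrow> b x y * \<bar>f x - f y\<bar>\<^sup>2))"
     "(\<lambda>p. (grad f (Inr p))\<^sup>2) = (\<lambda>x. c x * \<bar>f x\<bar>\<^sup>2)"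
    by (auto simp: power_mult_distrib b_nonneg c_nonneg)
  have "f \<in> FE \<longleftrightarrow> (\<lambda>p. (grad f (Inl p))\<^sup>2) summable_on UNIV \<and> (\<lambda>p. (grad f (Inr p))\<^sup>2) summable_on UNIV"
    unfolding * finite_energy_iff[OF weighted]
    by (subst summable_on_cmult_right') auto
  also have "\<dots> \<longleftrightarrow> (\<lambda>i. (grad f i)\<^sup>2) summable_on UNIV"
  proof
    assume "(\<lambda>p. (grad f (Inl p))\<^sup>2) summable_on UNIV \<and> (\<lambda>p. (grad f (Inr p))\<^sup>2) summable_on UNIV"
    then obtain s t where "((\<lambda>p. (grad f (Inl p))\<^sup>2) has_sum s) UNIV" "((\<lambda>p. (grad f (Inr p))\<^sup>2) has_sum t) UNIV"
      by (auto simp: summable_on_def)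
    then have "((\<lambda>i. (grad f i)\<^sup>2) has_sum (s + t)) UNIV"
      by (rule has_sum_sum_type)
    then show "(\<lambda>i. (grad f i)\<^sup>2) summable_on UNIV"
      by (rule has_sum_imp_summable)
  next
    assume "(\<lambda>i. (grad f i)\<^sup>2) summable_on UNIV"
    then have "(\<lambda>i. (grad f i)\<^sup>2) summable_on (range Inl)" "(\<lambda>i. (grad f i)\<^sup>2) summable_on (range Inr)"
      by (rule summable_on_subset_banach, simp)+
    then show "(\<lambda>p. (grad f (Inl p))\<^sup>2) summable_on UNIV \<and> (\<lambda>p. (grad f (Inr p))\<^sup>2) summable_on UNIV"
      by (simp add: summable_on_reindex o_def)
  qed
  finally show ?thesis .
qed

lemma energy_eq_Q:
  assumes "f \<in> FE"
  shows "energy b c f = ennreal (Q f)"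
proof -
  define g1 where "g1 = (\<lambda>(x, y). b x y * \<bar>f x - f y\<bar>\<^sup>2)"
  define g2 where "g2 = (\<lambda>x. c x * \<bar>f x\<bar>\<^sup>2)"
  have g: "g1 summable_on UNIV" "g2 summable_on UNIV" "\<And>p. 0 \<le> g1 p" "\<And>p. 0 \<le> g2 p"
    using assms b_nonneg c_nonneg by (auto simp: finite_energy_iff[OF weighted] g1_def g2_def)
  have *: "(\<lambda>p. (grad f (Inl p))\<^sup>2) = (\<lambda>p. (1/2) * g1 p)"
     "(\<lambda>p. (grad f (Inr p))\<^sup>2) = g2"
    by (auto simp: power_mult_distrib b_nonneg c_nonneg g1_def g2_def)
  have "((\<lambda>i. (grad f i)\<^sup>2) has_sum (1/2 * infsum g1 UNIV + infsum g2 UNIV)) UNIV"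
    by (rule has_sum_sum_type; unfold *; intro has_sum_cmult_right has_sum_infsum g)
  then have Q: "Q f = 1/2 * infsum g1 UNIV + infsum g2 UNIV"
    by (simp add: Q_def infsumI)
  have "energy b c f = 1/2 * (\<Sum>\<^sub>\<infinity>p\<in>UNIV. ennreal (g1 p)) + (\<Sum>\<^sub>\<infinity>p\<in>UNIV. ennreal (g2 p))"
    unfolding energy_def g1_def g2_def by (simp add: case_prod_unfold)
  also have "\<dots> = 1/2 * ennreal (infsum g1 UNIV) + ennreal (infsum g2 UNIV)"
    using g by (simp add: ennreal_infsum)
  also have "1/2 = ennreal (1/2)"
    by (metis divide_ennreal ennreal_1 ennreal_numeral zero_le_one zero_le_numeral zero_less_numeral)
  also have "ennreal (1/2) * ennreal (infsum g1 UNIV) + ennreal (infsum g2 UNIV) = ennreal (Q f)"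
    unfolding Q using g
    by (subst ennreal_mult[symmetric]) (auto simp: infsum_nonneg ennreal_plus)
  finally show ?thesis .
qed

lemma Q_nonneg: "0 \<le> Q f"
  by (simp add: Q_def infsum_nonneg)

lemma energy_norm_eq:
  assumes "f \<in> FE"
  shows "energy_norm b c z f = sqrt (Q f + (f z)\<^sup>2)"
  by (simp add: energy_norm_def energy_eq_Q[OF assms] Q_nonneg)

lemma energy_norm_nonneg: "0 \<le> energy_norm b c z f"
  by (simp add: energy_norm_def)

lemma Q_le_energy_norm_power2: "f \<in> FE \<Longrightarrow> Q f \<le> (energy_norm b c z f)\<^sup>2"
  by (simp add: energy_norm_eq Q_nonneg)

lemma abs_le_energy_norm: "f \<in> FE \<Longrightarrow> \<bar>f z\<bar> \<le> energy_norm b c z f"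
  by (simp add: energy_norm_eq Q_nonneg real_le_rsqrt)

lemma FE_diff: "f \<in> FE \<Longrightarrow> g \<in> FE \<Longrightarrow> (\<lambda>x. f x - g x) \<in> FE"
  using finite_energy_diff[OF weighted] .

lemma FE_cmult: "f \<in> FE \<Longrightarrow> (\<lambda>x. t * f x) \<in> FE"
  by (simp add: FE_iff grad_cmult power_mult_distrib summable_on_cmult_right)

lemma Q_cmult: "Q (\<lambda>x. t * f x) = t\<^sup>2 * Q f"
  by (simp add: Q_def grad_cmult power_mult_distrib infsum_cmult_right')

lemma FE_add: "f \<in> FE \<Longrightarrow> g \<in> FE \<Longrightarrow> (\<lambda>x. f x + g x) \<in> FE"
  using FE_diff[of f "\<lambda>x. (-1) * g x"] FE_cmult[of g "-1"] by simp

lemma Cc_subset_FE: "Cc \<subseteq> FE"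
  by (rule Cc_subset_finite_energy[OF weighted])

text \<open>Summing a termwise gradient bound is done once here, for sums, absolute values and
  maxima; finiteness of the energy comes from the same comparison.\<close>

lemma FE_Q_le_comb:
  assumes "g \<in> FE" "h \<in> FE" "\<And>i. (grad f i)\<^sup>2 \<le> s * (grad g i)\<^sup>2 + t * (grad h i)\<^sup>2"
  shows "f \<in> FE" "Q f \<le> s * Q g + t * Q h"
proof -
  have sm: "(\<lambda>i. s * (grad g i)\<^sup>2 + t * (grad h i)\<^sup>2) summable_on UNIV"
    using assms(1,2) by (intro summable_on_add summable_on_cmult_right) (simp_all add: FE_iff)
  show f: "f \<in> FE"
    unfolding FE_iff by (rule summable_on_comparison_test[OF sm]) (use assms(3) in auto)
  have "Q f \<le> (\<Sum>\<^sub>\<infinity>i\<in>UNIV. s * (grad g i)\<^sup>2 + t * (grad h i)\<^sup>2)"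
    unfolding Q_def using f sm assms(3) by (intro infsum_mono) (auto simp: FE_iff)
  also have "\<dots> = s * Q g + t * Q h"
    using assms(1,2) unfolding Q_def
    by (subst infsum_add) (auto simp: FE_iff summable_on_cmult_right infsum_cmult_right')
  finally show "Q f \<le> s * Q g + t * Q h" .
qed

lemma Q_add_le:
  assumes "f \<in> FE" "g \<in> FE" "0 < e"
  shows "Q (\<lambda>x. f x + g x) \<le> (1 + e) * Q f + (1 + 1 / e) * Q g"
  by (rule FE_Q_le_comb[OF assms(1,2)]) (simp add: grad_add weighted_square_add_le[OF assms(3)])

text \<open>Contraction property of the energy: by the reverse triangle inequality no edge
  difference grows.\<close>

lemma FE_abs: assumes "f \<in> FE" shows "(\<lambda>x. \<bar>f x\<bar>) \<in> FE" "Q (\<lambda>x. \<bar>f x\<bar>) \<le> Q f"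
proof -
  have "(grad (\<lambda>x. \<bar>f x\<bar>) i)\<^sup>2 \<le> 1 * (grad f i)\<^sup>2 + 0 * (grad f i)\<^sup>2" for i
  proof (cases i rule: grad_cases)
    case (1 x y)
    have "(\<bar>f x\<bar> - \<bar>f y\<bar>)\<^sup>2 \<le> (f x - f y)\<^sup>2" by (simp add: abs_le_square_iff[symmetric])
    then show ?thesis
      by (simp add: 1 power_mult_distrib b_nonneg mult_left_mono)
  qed (simp add: power_mult_distrib)
  from FE_Q_le_comb[OF assms assms this] show "(\<lambda>x. \<bar>f x\<bar>) \<in> FE" "Q (\<lambda>x. \<bar>f x\<bar>) \<le> Q f"
    by auto
qed

lemma FE_max:
  assumes "f \<in> FE" "g \<in> FE"
  shows "(\<lambda>x. max (f x) (g x)) \<in> FE" "Q (\<lambda>x. max (f x) (g x)) \<le> Q f + Q g"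
proof -
  have "(grad (\<lambda>x. max (f x) (g x)) i)\<^sup>2 \<le> 1 * (grad f i)\<^sup>2 + 1 * (grad g i)\<^sup>2" for i
  proof (cases i rule: grad_cases)
    case (1 x y)
    show ?thesis
      using mult_left_mono[OF max_diff_power2_le[of "f x" "g x" "f y" "g y"] b_nonneg[of x y]]
      by (simp add: 1 power_mult_distrib b_nonneg distrib_left)
  next
    case (2 x)
    show ?thesis
      using mult_left_mono[OF max_diff_power2_le[of "f x" "g x" 0 0] c_nonneg[of x]]
      by (simp add: 2 power_mult_distrib c_nonneg distrib_left)
  qed
  from FE_Q_le_comb[OF assms this]
  show "(\<lambda>x. max (f x) (g x)) \<in> FE" "Q (\<lambda>x. max (f x) (g x)) \<le> Q f + Q g"
    by auto
qed

lemma Q_parallelogram: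
  assumes "f \<in> FE" "g \<in> FE"
  shows "Q (\<lambda>x. f x + g x) + Q (\<lambda>x. f x - g x) = 2 * Q f + 2 * Q g"
proof -
  have "Q (\<lambda>x. f x + g x) + Q (\<lambda>x. f x - g x)
      = (\<Sum>\<^sub>\<infinity>i\<in>UNIV. (grad (\<lambda>x. f x + g x) i)\<^sup>2 + (grad (\<lambda>x. f x - g x) i)\<^sup>2)"
    unfolding Q_def using FE_add[OF assms] FE_diff[OF assms]
    by (intro infsum_add[symmetric]) (auto simp: FE_iff)
  also have "\<dots> = (\<Sum>\<^sub>\<infinity>i\<in>UNIV. 2 * (grad f i)\<^sup>2 + 2 * (grad g i)\<^sup>2)"
    by (simp add: grad_add grad_diff power2_eq_square algebra_simps)
  also have "\<dots> = 2 * Q f + 2 * Q g"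
    using assms unfolding Q_def
    by (subst infsum_add) (auto simp: FE_iff summable_on_cmult_right infsum_cmult_right')
  finally show ?thesis .
qed

lemma grad_tendsto:
  assumes "\<And>x. (\<lambda>n. f n x) \<longlonglongrightarrow> g x"
  shows "(\<lambda>n. grad (f n) i) \<longlonglongrightarrow> grad g i"
  by (cases i rule: grad_cases) (auto intro!: tendsto_intros assms)

text \<open>Lower semicontinuity of the energy under pointwise convergence. A finite partial sum
  involves finitely many values and passes to the limit, and a nonnegative sum is the supremum of
  its finite partial sums.\<close>

lemma Fatou_Q:
  assumes lim: "\<And>x. (\<lambda>n. f n x) \<longlonglongrightarrow> g x"
    and ev: "eventually (\<lambda>n. f n \<in> FE \<and> Q (f n) \<le> M) sequentially"
  shows "g \<in> FE" "Q g \<le> M"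
proof -
  have fin: "(\<Sum>i\<in>F. (grad g i)\<^sup>2) \<le> M" if "finite F" for F
  proof (rule tendsto_upperbound)
    show "(\<lambda>n. \<Sum>i\<in>F. (grad (f n) i)\<^sup>2) \<longlonglongrightarrow> (\<Sum>i\<in>F. (grad g i)\<^sup>2)"
      by (intro tendsto_intros grad_tendsto lim)
    show "\<forall>\<^sub>F n in sequentially. (\<Sum>i\<in>F. (grad (f n) i)\<^sup>2) \<le> M"
      using ev
    proof eventually_elim
      case (elim n)
      have "(\<Sum>i\<in>F. (grad (f n) i)\<^sup>2) \<le> Q (f n)"
        unfolding Q_def using elim that by (intro finite_sum_le_infsum) (auto simp: FE_iff)
      with elim show ?case by linarith
    qed
  qed simp
  show g: "g \<in> FE"
    unfolding FE_iff by (rule nonneg_bdd_above_summable_on) (auto intro!: bdd_aboveI[of _ M] fin)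
  show "Q g \<le> M"
    unfolding Q_def using g fin by (intro infsum_le_finite_sums) (auto simp: FE_iff)
qed

lemma grad_power2_le_Q:
  assumes "f \<in> FE"
  shows "(grad f i)\<^sup>2 \<le> Q f"
  using finite_sum_le_infsum[of "\<lambda>i. (grad f i)\<^sup>2" UNIV "{i}"] assms
  by (simp add: FE_iff Q_def)

text \<open>A single edge term is at most the whole energy; the 2 undoes the factor
  \<open>1 / 2\<close> inside \<open>grad\<close>.\<close>

lemma edge_bound:
  assumes "f \<in> FE" "0 < b x y"
  shows "\<bar>f x - f y\<bar> \<le> sqrt (2 / b x y) * sqrt (Q f)"
proof -
  have "b x y / 2 * (f x - f y)\<^sup>2 \<le> Q f"
    using grad_power2_le_Q[OF assms(1), of "Inl (x, y)"] assms(2) by (simp add: power_mult_distrib)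
  then have "(f x - f y)\<^sup>2 \<le> 2 / b x y * Q f"
    using assms(2) by (simp add: field_simps)
  then show ?thesis
    by (metis real_sqrt_abs real_sqrt_le_iff real_sqrt_mult)
qed

lemma killing_bound:
  assumes "f \<in> FE" "0 < c x"
  shows "\<bar>f x\<bar> \<le> sqrt (1 / c x) * sqrt (Q f)"
proof -
  have "c x * (f x)\<^sup>2 \<le> Q f"
    using grad_power2_le_Q[OF assms(1), of "Inr x"] assms(2) by (simp add: power_mult_distrib)
  then have "(f x)\<^sup>2 \<le> 1 / c x * Q f"
    using assms(2) by (simp add: field_simps)
  then show ?thesis
    by (metis real_sqrt_abs real_sqrt_le_iff real_sqrt_mult)
qed

section \<open>The Laplacian and harmonicity of energy minimisers\<close>

text \<open>Since \<open>\<bar>s\<bar> \<le> 1 + s^2\<close>, the differences are dominated by the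
  weights at \<open>x\<close> plus the row of the energy at \<open>x\<close>, both summable.\<close>

lemma laplacian_summands_summable:
  assumes "f \<in> FE"
  shows "(\<lambda>y. b x y * (f x - f y)) summable_on UNIV"
    and "(\<lambda>y. b x y * \<bar>f y\<bar>) summable_on UNIV"
proof -
  have "(\<lambda>(u, v). b u v * \<bar>f u - f v\<bar>\<^sup>2) summable_on (range (Pair x))"
    using assms summable_on_subset_banach unfolding finite_energy_iff[OF weighted] by blast
  then have sq: "(\<lambda>y. b x y * (f x - f y)\<^sup>2) summable_on UNIV"
    by (subst (asm) summable_on_reindex) (auto simp: o_def inj_on_def)
  have "(\<lambda>y. b x y * \<bar>f x - f y\<bar>) summable_on UNIV"
  proof (rule summable_on_comparison_test)
    show "(\<lambda>y. b x y + b x y * (f x - f y)\<^sup>2) summable_on UNIV"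
      by (intro summable_on_add b_summable sq)
    fix y
    have "\<bar>f x - f y\<bar> \<le> 1 + (f x - f y)\<^sup>2"
      using sum_squares_bound[of 1 "\<bar>f x - f y\<bar>"] abs_ge_zero[of "f x - f y"]
      by (simp del: abs_ge_zero)
    from mult_left_mono[OF this b_nonneg] show "b x y * \<bar>f x - f y\<bar> \<le> b x y + b x y * (f x - f y)\<^sup>2"
      by (simp add: distrib_left)
  qed (simp add: b_nonneg)
  note abs = this
  show "(\<lambda>y. b x y * (f x - f y)) summable_on UNIV"
    by (rule abs_summable_summable) (use abs b_nonneg in \<open>simp add: abs_mult\<close>)
  show "(\<lambda>y. b x y * \<bar>f y\<bar>) summable_on UNIV"
  proof (rule summable_on_comparison_test)
    show "(\<lambda>y. b x y * \<bar>f x - f y\<bar> + b x y * \<bar>f x\<bar>) summable_on UNIV"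
      by (intro summable_on_add abs summable_on_cmult_left b_summable)
    fix y
    show "b x y * \<bar>f y\<bar> \<le> b x y * \<bar>f x - f y\<bar> + b x y * \<bar>f x\<bar>"
      unfolding distrib_left[symmetric] by (intro mult_left_mono b_nonneg) linarith
  qed (simp add: b_nonneg)
qed

text \<open>Green's formula tested against a point mass: only edges at \<open>x\<close> contribute.
  By symmetry of \<open>b\<close>, the ordered pairs leaving \<open>x\<close> and those entering
  \<open>x\<close> each give half of the edge sum.\<close>

lemma Green_indicator:
  assumes "f \<in> FE"
  shows "((\<lambda>i. grad f i * grad (indicat_real {x}) i) has_sum graph_laplacian b c f x) UNIV"
proof -
  define k where "k = (\<lambda>y. b x y * (f x - f y) / 2)"
  define S where "S = (\<Sum>\<^sub>\<infinity>y\<in>UNIV. b x y * (f x - f y))"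
  have k: "(k has_sum S / 2) UNIV"
    unfolding k_def S_def divide_inverse
    by (intro has_sum_cmult_left has_sum_infsum laplacian_summands_summable(1)[OF assms])
  have row: "((\<lambda>p. if fst p = x then k (snd p) else 0) has_sum S / 2) UNIV"
  proof -
    have "((\<lambda>p. k (snd p)) has_sum S / 2) (range (Pair x))"
      using k by (subst has_sum_reindex) (auto simp: o_def inj_on_def)
    then show ?thesis
      by (rule has_sum_cong_neutral[THEN iffD1, rotated -1]) auto
  qed
  have col: "((\<lambda>p. if snd p = x then k (fst p) else 0) has_sum S / 2) UNIV"
  proof -
    have "((\<lambda>p. k (fst p)) has_sum S / 2) (range (\<lambda>y. (y, x)))"
      using k by (subst has_sum_reindex) (auto simp: o_def inj_on_def)
    then show ?thesis
      by (rule has_sum_cong_neutral[THEN iffD1, rotated -1]) auto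
  qed
  have "((\<lambda>p. grad f (Inl p) * grad (indicat_real {x}) (Inl p)) has_sum S / 2 + S / 2) UNIV"
  proof (rule has_sum_cong[THEN iffD1, OF _ has_sum_add[OF row col]])
    fix p :: "'a \<times> 'a"
    obtain u v where [simp]: "p = (u, v)" by (cases p)
    have half: "(sqrt (b u v / 2) * s) * (sqrt (b u v / 2) * t) = b u v / 2 * s * t" for s t
    proof -
      have "(sqrt (b u v / 2) * s) * (sqrt (b u v / 2) * t) = (sqrt (b u v / 2))\<^sup>2 * s * t"
        by (simp only: power2_eq_square mult_ac)
      then show ?thesis by (simp add: b_nonneg)
    qed
    have "grad f (Inl p) * grad (indicat_real {x}) (Inl p)
        = b u v / 2 * (f u - f v) * (indicat_real {x} u - indicat_real {x} v)"
      by (simp only: \<open>p = (u, v)\<close> grad_Inl half)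
    \<comment> \<open>The overlap \<open>u = v = x\<close> of row and column is harmless, because
      \<open>k x = 0\<close>.\<close>
    also have "\<dots> = (if u = x then k v else 0) + (if v = x then k u else 0)"
      by (cases "u = x"; cases "v = x") (simp_all add: k_def b_sym[of u x] algebra_simps)
    finally show "(if fst p = x then k (snd p) else 0) + (if snd p = x then k (fst p) else 0)
        = grad f (Inl p) * grad (indicat_real {x}) (Inl p)"
      by simp
  qed
  moreover have "((\<lambda>y. grad f (Inr y) * grad (indicat_real {x}) (Inr y)) has_sum c x * f x) UNIV"
  proof (rule has_sum_cong_neutral[THEN iffD1])
    show "((\<lambda>y. c y * f y) has_sum c x * f x) {x}"
      by (simp add: has_sum_finite_iff)
  qed (auto simp: indicator_def c_nonneg)
  ultimately have "((\<lambda>i. grad f i * grad (indicat_real {x}) i) has_sum S / 2 + S / 2 + c x * f x) UNIV"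
    by (rule has_sum_sum_type)
  then show ?thesis
    by (simp add: graph_laplacian_def S_def)
qed

text \<open>Perturbing \<open>h\<close> by \<open>t\<close> times a point mass at \<open>x\<close>
  makes the energy a quadratic polynomial in \<open>t\<close>, whose linear coefficient is twice the
  Laplacian at \<open>x\<close> by \<open>Green_indicator\<close>. Minimality at
  \<open>t = 0\<close> forces it to vanish.\<close>

lemma harmonic_if_minimal:
  assumes "h \<in> FE" and min: "\<And>\<psi>. \<psi> \<in> Cc \<Longrightarrow> Q h \<le> Q (\<lambda>x. h x + \<psi> x)"
  shows "graph_harmonic b c h"
proof -
  have "graph_laplacian b c h x = 0" for x
  proof (rule linear_coeff_zero_of_quadratic_nonneg[where K = "Q (indicat_real {x})"])
    fix t
    let ?d = "indicat_real {x}"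
    have d: "?d \<in> FE" by (rule subsetD[OF Cc_subset_FE indicator_Cc])
    have "((\<lambda>i. (grad h i)\<^sup>2 + (2 * t) * (grad h i * grad ?d i) + t\<^sup>2 * (grad ?d i)\<^sup>2) has_sum
        (Q h + (2 * t) * graph_laplacian b c h x + t\<^sup>2 * Q ?d)) UNIV"
      unfolding Q_def using assms(1) d
      by (intro has_sum_add has_sum_cmult_right Green_indicator has_sum_infsum) (auto simp: FE_iff)
    also have "(\<lambda>i. (grad h i)\<^sup>2 + (2 * t) * (grad h i * grad ?d i) + t\<^sup>2 * (grad ?d i)\<^sup>2)
        = (\<lambda>i. (grad (\<lambda>y. h y + t * ?d y) i)\<^sup>2)"
      by (simp add: grad_add grad_cmult power2_eq_square algebra_simps)
    finally have "Q (\<lambda>y. h y + t * ?d y) = Q h + (2 * t) * graph_laplacian b c h x + t\<^sup>2 * Q ?d"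
      unfolding Q_def[of "\<lambda>y. h y + t * ?d y"] by (rule infsumI)
    with min[OF Cc_cmult[OF indicator_Cc], of t x]
    show "0 \<le> 2 * t * graph_laplacian b c h x + t\<^sup>2 * Q ?d" by simp
  qed
  then show ?thesis
    unfolding graph_harmonic_def using laplacian_summands_summable(2)[OF assms(1)] by blast
qed

end

section \<open>Pointwise control by the energy on connected graphs\<close>

locale connected_weighted = weighted +
  assumes connected: "connected_graph b"
begin

text \<open>Edge bounds add up along a path from \<open>x\<close> to \<open>y\<close>; the constant
  depends on the path only, not on \<open>f\<close>.\<close>

lemma oscillation_bound:
  obtains K where "0 \<le> K" "\<And>f. f \<in> FE \<Longrightarrow> \<bar>f x - f y\<bar> \<le> K * sqrt (Q f)"
proof -
  have path: "\<exists>K\<ge>0. \<forall>f\<in>FE. \<bar>f (p 0) - f (p n)\<bar> \<le> K * sqrt (Q f)"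
    if "\<forall>i\<in>{1..n}. b (p (i - 1)) (p i) > 0" for n :: nat and p
    using that
  proof (induction n)
    case 0
    then show ?case by (auto intro: exI[of _ 0])
  next
    case (Suc n)
    then obtain K where K: "K \<ge> 0" "\<And>f. f \<in> FE \<Longrightarrow> \<bar>f (p 0) - f (p n)\<bar> \<le> K * sqrt (Q f)"
      by auto
    have e: "b (p n) (p (Suc n)) > 0" using Suc.prems by force
    define L where "L = sqrt (2 / b (p n) (p (Suc n)))"
    have "\<bar>f (p 0) - f (p (Suc n))\<bar> \<le> (K + L) * sqrt (Q f)" if "f \<in> FE" for f
      using K(2)[OF that] edge_bound[OF that e] unfolding L_def distrib_right by linarith
    moreover have "0 \<le> K + L" using K(1) e by (simp add: L_def)
    ultimately show ?case by blast
  qed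
  show ?thesis
  proof (cases "x = y")
    case True
    then show ?thesis using that[of 0] by simp
  next
    case False
    then obtain n :: nat and p where "p 0 = x" "p n = y" "\<forall>i\<in>{1..n}. b (p (i - 1)) (p i) > 0"
      using connected unfolding connected_graph_def by blast
    then show ?thesis using path that by metis
  qed
qed

lemma evaluation_bound:
  obtains K where "0 < K" "\<And>f. f \<in> FE \<Longrightarrow> \<bar>f x\<bar> \<le> K * energy_norm b c z f"
proof -
  obtain K where K: "0 \<le> K" "\<And>f. f \<in> FE \<Longrightarrow> \<bar>f x - f z\<bar> \<le> K * sqrt (Q f)"
    using oscillation_bound[of x z] by blast
  have "\<bar>f x\<bar> \<le> (K + 1) * energy_norm b c z f" if "f \<in> FE" for f
  proof -
    have "sqrt (Q f) \<le> energy_norm b c z f" "\<bar>f z\<bar> \<le> energy_norm b c z f"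
      by (auto simp: energy_norm_eq[OF that] Q_nonneg real_le_rsqrt)
    with K(2)[OF that] mult_left_mono[OF this(1) K(1)] show ?thesis
      by (simp add: distrib_right)
  qed
  with that[of "K + 1"] K(1) show ?thesis by simp
qed

section \<open>From canonical compactifiability to uniform transience\<close>

text \<open>If no such constant existed, the supremum of suitably rescaled functions would be an
  unbounded function of finite energy, as the energy of a maximum is at most the sum of the
  energies.\<close>

lemma sup_le_energy_norm:
  assumes cc: "canonically_compactifiable b c"
  shows "\<exists>C>0. \<forall>f\<in>FE. \<forall>x. \<bar>f x\<bar> \<le> C * energy_norm b c z f"
proof (rule ccontr)
  let ?N = "energy_norm b c z"
  assume "\<not> ?thesis"
  then have "\<exists>f x. f \<in> FE \<and> \<bar>f x\<bar> > C * ?N f" if "0 < C" for C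
    using that by (meson not_le)
  \<comment> \<open>The factor \<open>2 ^ n\<close> is spent on making the rescaled energies
    summable; the factor \<open>Suc n\<close> survives and forces unboundedness.\<close>
  then have "\<exists>f x. f \<in> FE \<and> \<bar>f x\<bar> > (real (Suc n) * 2 ^ n) * ?N f" for n
    by simp
  then obtain F X where F: "\<And>n. F n \<in> FE" and
    X: "\<And>n. \<bar>F n (X n)\<bar> > (real (Suc n) * 2 ^ n) * ?N (F n)"
    by metis
  \<comment> \<open>A vanishing norm would give \<open>F n (X n) = 0\<close> by the evaluation
    bound, against \<open>X\<close>.\<close>
  have N: "0 < ?N (F n)" for n
  proof -
    obtain K where K: "\<bar>F n (X n)\<bar> \<le> K * ?N (F n)"
      using evaluation_bound[of "X n" z] F by metis
    have "?N (F n) \<noteq> 0" using K X[of n] by auto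
    then show ?thesis using energy_norm_nonneg[of z "F n"] by linarith
  qed
  \<comment> \<open>Scales \<open>F n\<close> to energy norm \<open>1 / 2 ^ n\<close>, while its
    absolute value at \<open>X n\<close> stays above \<open>Suc n\<close>.\<close>
  define t where "t n = 1 / (2 ^ n * ?N (F n))" for n
  define g where "g n x = t n * \<bar>F n x\<bar>" for n x
  have tN: "t n * ?N (F n) = 1 / 2 ^ n" and t: "0 < t n" for n
    using N[of n] by (auto simp: t_def)
  have g_FE: "g n \<in> FE" for n
    unfolding g_def by (intro FE_cmult FE_abs F)
  have Qg: "Q (g n) \<le> 1 / 4 ^ n" for n
  proof -
    have "Q (g n) \<le> (t n)\<^sup>2 * Q (F n)"
      unfolding g_def Q_cmult by (intro mult_left_mono FE_abs F) simp
    also have "\<dots> \<le> (t n)\<^sup>2 * (?N (F n))\<^sup>2"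
      by (intro mult_left_mono Q_le_energy_norm_power2 F) simp
    also have "\<dots> = (1 / 2 ^ n)\<^sup>2"
      unfolding power_mult_distrib[symmetric] tN ..
    also have "\<dots> = 1 / 4 ^ n"
      by (simp add: power_divide power_even_eq[symmetric] power_mult)
    finally show ?thesis .
  qed
  have gz: "g n z \<le> 1" for n
  proof -
    have "g n z \<le> t n * ?N (F n)"
      unfolding g_def using t[of n] by (intro mult_left_mono abs_le_energy_norm F) simp
    also have "\<dots> \<le> 1" by (simp add: tN)
    finally show ?thesis .
  qed
  have gX: "real (Suc n) < g n (X n)" for n
  proof -
    have "real (Suc n) = t n * ((real (Suc n) * 2 ^ n) * ?N (F n))"
      using N[of n] by (simp add: t_def)
    also have "\<dots> < g n (X n)"
      unfolding g_def using t[of n] X[of n] by (intro mult_strict_left_mono)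
    finally show ?thesis .
  qed
  \<comment> \<open>Finite maxima have their energy controlled by \<open>FE_max\<close>; the full
    supremum is then reached as a monotone limit through \<open>Fatou_Q\<close>.\<close>
  define G where "G n x = (MAX k\<in>{..n}. g k x)" for n x
  have G0: "G 0 = g 0" and GS: "G (Suc n) = (\<lambda>x. max (g (Suc n) x) (G n x))" for n
    by (auto simp: G_def atMost_Suc fun_eq_iff)
  \<comment> \<open>The term \<open>1 / 4 ^ n\<close> is slack for the induction: passing to
    \<open>Suc n\<close> frees three times \<open>1 / 4 ^ Suc n\<close>, more than the energy that
    is added.\<close>
  have G: "G n \<in> FE \<and> Q (G n) \<le> 2 - 1 / 4 ^ n" for n
  proof (induction n)
    case 0
    then show ?case using g_FE[of 0] Qg[of 0] by (simp add: G0)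
  next
    case (Suc n)
    have "Q (G (Suc n)) \<le> Q (g (Suc n)) + Q (G n)"
      unfolding GS using g_FE Suc by (intro FE_max) auto
    also have "\<dots> \<le> 1 / 4 ^ Suc n + (2 - 1 / 4 ^ n)"
      using Qg[of "Suc n"] Suc by linarith
    also have "\<dots> \<le> 2 - 1 / 4 ^ Suc n"
      by (simp add: field_simps)
    finally show ?case
      unfolding GS using g_FE Suc by (auto intro: FE_max)
  qed
  have g_le_G: "g k x \<le> G n x" if "k \<le> n" for k n x
    unfolding G_def using that by (intro Max_ge) auto
  have Gz: "\<bar>G n z\<bar> \<le> 1" for n
  proof -
    have "G n z \<le> 1" unfolding G_def using gz by (subst Max_le_iff) auto
    moreover have "0 \<le> G n z"
      using g_le_G[of 0 n z] t[of 0] by (auto simp: g_def intro: order_trans[rotated])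
    ultimately show ?thesis by simp
  qed
  have NG: "?N (G n) \<le> 2" for n
  proof -
    have "Q (G n) \<le> 2" using G[of n] by (smt (verit) divide_nonneg_nonneg zero_le_power zero_le_one)
    moreover have "(G n z)\<^sup>2 \<le> 1" using Gz[of n] by (simp add: abs_square_le_1)
    ultimately show ?thesis
      using G[of n] by (subst energy_norm_eq) (auto intro!: real_le_lsqrt simp: Q_nonneg)
  qed
  \<comment> \<open>The uniform norm bound becomes a bound at each vertex by
    \<open>evaluation_bound\<close>, so the monotone sequence converges. That the limit dominates
    every \<open>G n\<close> preserves the large values at \<open>X n\<close>.\<close>
  have conv: "\<exists>L. (\<lambda>n. G n x) \<longlonglongrightarrow> L \<and> (\<forall>n. G n x \<le> L)" for x
  proof -
    obtain K where K: "0 < K" "\<And>f. f \<in> FE \<Longrightarrow> \<bar>f x\<bar> \<le> K * ?N f"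
      using evaluation_bound[of x z] by blast
    have "G n x \<le> K * 2" for n
    proof -
      have "\<bar>G n x\<bar> \<le> K * ?N (G n)" using K(2) G by blast
      also have "\<dots> \<le> K * 2" using K(1) NG by simp
      finally show ?thesis by simp
    qed
    moreover have "incseq (\<lambda>n. G n x)"
      by (intro incseq_SucI) (simp add: GS)
    ultimately show ?thesis
      by (meson incseq_convergent)
  qed
  then obtain L where L: "\<And>x. (\<lambda>n. G n x) \<longlonglongrightarrow> L x" "\<And>n x. G n x \<le> L x"
    by metis
  have "L \<in> FE"
  proof (rule Fatou_Q(1)[OF L(1)])
    have "Q (G n) \<le> 2" for n using G[of n] by (smt (verit) divide_nonneg_nonneg zero_le_power zero_le_one)
    then show "\<forall>\<^sub>F n in sequentially. G n \<in> FE \<and> Q (G n) \<le> 2"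
      using G by simp
  qed
  then obtain B where B: "\<And>x. \<bar>L x\<bar> \<le> B"
    using cc unfolding canonically_compactifiable_def by (metis linftyE subsetD)
  obtain n where "B < real n" using reals_Archimedean2 by blast
  moreover have "real (Suc n) < L (X n)"
    using gX[of n] g_le_G[OF order_refl, of n "X n"] L(2)[of n "X n"] by linarith
  ultimately show False
    using B[of "X n"] by auto
qed

lemma uniformly_transient_if_canonically_compactifiable:
  assumes "canonically_compactifiable b c"
  shows "uniformly_transient b c z"
  unfolding uniformly_transient_def
proof
  fix f
  assume "f \<in> finite_energy0 b c z"
  then have f: "f \<in> FE" and approx: "\<And>e. 0 < e \<Longrightarrow> \<exists>\<phi>\<in>Cc. energy_norm b c z (\<lambda>x. f x - \<phi> x) < e"
    by (auto simp: finite_energy0_def)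
  obtain C where C: "0 < C" "\<And>f x. f \<in> FE \<Longrightarrow> \<bar>f x\<bar> \<le> C * energy_norm b c z f"
    using sup_le_energy_norm[OF assms, of z] by blast
  show "f \<in> C0"
    unfolding C0_def
  proof (intro CollectI allI impI)
    fix e :: real
    assume e: "0 < e"
    obtain \<phi> where \<phi>: "\<phi> \<in> Cc" "energy_norm b c z (\<lambda>x. f x - \<phi> x) < e / (2 * C)"
      using approx[of "e / (2 * C)"] e C(1) by auto
    \<comment> \<open>Halving \<open>e\<close> keeps the inequality strict after passing to the
      supremum.\<close>
    have "\<bar>f x - \<phi> x\<bar> \<le> e / 2" for x
    proof -
      have "\<bar>f x - \<phi> x\<bar> \<le> C * energy_norm b c z (\<lambda>x. f x - \<phi> x)"
        using C(2)[OF FE_diff[OF f subsetD[OF Cc_subset_FE \<phi>(1)]]] .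
      also have "\<dots> \<le> C * (e / (2 * C))"
        using \<phi>(2) C(1) by (intro mult_left_mono) auto
      finally show ?thesis using C(1) by simp
    qed
    then have "sup_norm (\<lambda>x. f x - \<phi> x) \<le> ennreal (e / 2)"
      by (rule sup_norm_le)
    also have "\<dots> < ennreal e" using e by (simp add: ennreal_less_iff)
    finally show "\<exists>\<phi>\<in>Cc. sup_norm (\<lambda>x. f x - \<phi> x) < ennreal e"
      using \<phi>(1) by blast
  qed
qed

section \<open>From uniform transience to the Royden decomposition\<close>

text \<open>Without such a constant the graph would be recurrent: there would be no killing, and the
  constant function \<open>1\<close> would be approximable by finitely supported functions.\<close>

lemma Cc_le_sqrt_Q:
  assumes ut: "uniformly_transient b c z" and inf: "infinite (UNIV :: 'a set)"
  obtains C where "0 < C" "\<And>\<phi>. \<phi> \<in> Cc \<Longrightarrow> \<bar>\<phi> z\<bar> \<le> C * sqrt (Q \<phi>)"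
proof (cases "\<exists>x. 0 < c x")
  case True
  \<comment> \<open>At a vertex with killing the energy bounds the value itself, and a path carries
    this bound to \<open>z\<close>.\<close>
  then obtain x where x: "0 < c x" by blast
  obtain K where K: "0 \<le> K" "\<And>f. f \<in> FE \<Longrightarrow> \<bar>f z - f x\<bar> \<le> K * sqrt (Q f)"
    using oscillation_bound[of z x] by blast
  have "\<bar>\<phi> z\<bar> \<le> (K + sqrt (1 / c x)) * sqrt (Q \<phi>)" if "\<phi> \<in> Cc" for \<phi>
  proof -
    have "\<phi> \<in> FE" using that Cc_subset_FE by blast
    from K(2)[OF this] killing_bound[OF this x] show ?thesis
      unfolding distrib_right by linarith
  qed
  moreover have "0 < K + sqrt (1 / c x)"
    using K(1) x by (simp add: add_nonneg_pos)
  ultimately show ?thesis using that by blast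
next
  case False
  then have c0: "c x = 0" for x
    using c_nonneg[of x] by (metis less_eq_real_def)
  show ?thesis
  proof (rule ccontr)
    assume no: "\<not> thesis"
    \<comment> \<open>Without killing, constants have zero gradient. Hence the constant 1 has finite
      energy, and \<open>1 - \<psi>\<close> has the same energy as \<open>\<psi>\<close>.\<close>
    have Q1: "(grad (\<lambda>_. t) i)\<^sup>2 = 0" for t i
      by (cases i rule: grad_cases) (simp_all add: c0)
    have one: "(\<lambda>_. 1) \<in> FE" "Q (\<lambda>_. 1) = 0"
      by (simp_all only: FE_iff Q_def Q1) simp_all
    have "(\<lambda>_. 1) \<in> finite_energy0 b c z"
      unfolding finite_energy0_def
    proof (intro CollectI conjI allI impI one(1))
      fix e :: real
      assume e: "0 < e"
      have "\<not> (\<forall>\<phi>\<in>Cc. \<bar>\<phi> z\<bar> \<le> 1 / e * sqrt (Q \<phi>))"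
        using no that[of "1 / e"] e by auto
      then obtain \<phi> where \<phi>: "\<phi> \<in> Cc" "1 / e * sqrt (Q \<phi>) < \<bar>\<phi> z\<bar>"
        by (auto simp: not_le)
      have pos: "0 < \<bar>\<phi> z\<bar>"
        using \<phi>(2) e Q_nonneg[of \<phi>] by (intro le_less_trans[OF _ \<phi>(2)]) simp
      \<comment> \<open>The value 1 at \<open>z\<close> removes the pointwise part of the norm of
        \<open>1 - \<psi>\<close>; what is left is
        \<open>sqrt (Q \<phi>) / \<bar>\<phi> z\<bar>\<close>, below \<open>e\<close> because
        \<open>1 / e\<close> failed as a constant for \<open>\<phi>\<close>.\<close>
      define \<psi> where "\<psi> x = 1 / \<phi> z * \<phi> x" for x
      have \<psi>: "\<psi> \<in> Cc" unfolding \<psi>_def by (rule Cc_cmult[OF \<phi>(1)])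
      then have d: "(\<lambda>x. 1 - \<psi> x) \<in> FE"
        using one(1) Cc_subset_FE by (intro FE_diff) auto
      have "(grad (\<lambda>x. 1 - \<psi> x) i)\<^sup>2 = (grad \<psi> i)\<^sup>2" for i
        using Q1[of 1 i] by (simp add: grad_diff)
      then have "Q (\<lambda>x. 1 - \<psi> x) = Q \<psi>" by (simp add: Q_def)
      also have "\<dots> = Q \<phi> / (\<phi> z)\<^sup>2"
        unfolding \<psi>_def Q_cmult by (simp add: power_divide)
      finally have "energy_norm b c z (\<lambda>x. 1 - \<psi> x) = sqrt (Q \<phi>) / \<bar>\<phi> z\<bar>"
        unfolding energy_norm_eq[OF d] using pos by (simp add: \<psi>_def real_sqrt_divide)
      also have "\<dots> < e"
        using \<phi>(2) pos e by (simp add: field_simps)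
      finally show "\<exists>\<phi>\<in>Cc. energy_norm b c z (\<lambda>x. 1 - \<phi> x) < e"
        using \<psi> by blast
    qed
    then show False
      using ut one_notin_C0[OF inf] unfolding uniformly_transient_def by blast
  qed
qed

text \<open>The Royden decomposition: \<open>g\<close> is the limit of a minimising sequence for the distance of
  \<open>f\<close> to \<^const>\<open>Cc\<close>, which is Cauchy by the parallelogram identity.\<close>

lemma Royden_decomposition:
  assumes f: "f \<in> FE" and C: "\<And>\<phi>. \<phi> \<in> Cc \<Longrightarrow> \<bar>\<phi> z\<bar> \<le> C * sqrt (Q \<phi>)"
  obtains g where "g \<in> finite_energy0 b c z"
    "graph_harmonic b c (\<lambda>x. f x - g x)" "(\<lambda>x. f x - g x) \<in> FE"
proof -
  define m where "m = (INF \<phi>\<in>Cc. Q (\<lambda>x. f x - \<phi> x))"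
  have ne: "(\<lambda>\<phi>. Q (\<lambda>x. f x - \<phi> x)) ` Cc \<noteq> {}"
    using indicator_Cc[of z] by auto
  have bdd: "bdd_below ((\<lambda>\<phi>. Q (\<lambda>x. f x - \<phi> x)) ` Cc)"
    by (intro bdd_belowI2[of _ 0] Q_nonneg)
  have m_le: "m \<le> Q (\<lambda>x. f x - \<phi> x)" if "\<phi> \<in> Cc" for \<phi>
    unfolding m_def by (rule cINF_lower[OF bdd that])
  have "\<exists>\<phi>\<in>Cc. Q (\<lambda>x. f x - \<phi> x) < m + inverse (real (Suc n))" for n
    using cINF_less_iff[OF _ bdd, of "m + inverse (real (Suc n))"] ne unfolding m_def by auto
  then obtain \<phi> where \<phi>: "\<And>n. \<phi> n \<in> Cc"
    and Q\<phi>: "\<And>n. Q (\<lambda>x. f x - \<phi> n x) < m + inverse (real (Suc n))"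
    by metis
  have \<phi>_FE: "\<phi> n \<in> FE" for n using \<phi> Cc_subset_FE by blast
  have f\<phi>_FE: "(\<lambda>x. f x - \<phi> n x) \<in> FE" for n by (rule FE_diff[OF f \<phi>_FE])
  \<comment> \<open>The midpoint of \<open>\<phi> n\<close> and \<open>\<phi> k\<close> is again in
    \<open>Cc\<close>, so its distance term is at least \<open>m\<close>. In the parallelogram
    identity the multiples of \<open>m\<close> cancel, leaving twice the two errors.\<close>
  have diff: "Q (\<lambda>x. \<phi> k x - \<phi> n x) \<le> 4 * inverse (real (Suc n))" if "n \<le> k" for n k
  proof -
    have "Q (\<lambda>x. (f x - \<phi> n x) + (f x - \<phi> k x)) = Q (\<lambda>x. 2 * (f x - (1/2) * (\<phi> n x + \<phi> k x)))"
      by (simp add: algebra_simps)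
    also have "\<dots> \<ge> 4 * m"
      unfolding Q_cmult using m_le[OF Cc_cmult[OF Cc_add[OF \<phi> \<phi>]], of "1/2" n k] by simp
    finally have "4 * m \<le> Q (\<lambda>x. (f x - \<phi> n x) + (f x - \<phi> k x))" .
    moreover have "Q (\<lambda>x. (f x - \<phi> n x) - (f x - \<phi> k x)) = Q (\<lambda>x. \<phi> k x - \<phi> n x)"
      by simp
    moreover have "inverse (real (Suc k)) \<le> inverse (real (Suc n))"
      using that by (intro le_imp_inverse_le) auto
    ultimately show ?thesis
      using Q_parallelogram[OF f\<phi>_FE[of n] f\<phi>_FE[of k]] Q\<phi>[of n] Q\<phi>[of k] by linarith
  qed
  have small: "(\<lambda>n. s * (4 * inverse (real (Suc n)))) \<longlonglongrightarrow> 0" for s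
    by (intro tendsto_mult_right_zero LIMSEQ_inverse_real_of_nat)
  have "Cauchy (\<lambda>n. \<phi> n x)" for x
  proof -
    obtain K where K: "0 \<le> K" "\<And>f. f \<in> FE \<Longrightarrow> \<bar>f x - f z\<bar> \<le> K * sqrt (Q f)"
      using oscillation_bound[of x z] by blast
    \<comment> \<open>No sign of \<open>C\<close> is assumed; the absolute value justifies the
      monotone multiplications below.\<close>
    define M where "M = \<bar>K + C\<bar>"
    have bound: "\<bar>\<phi> k x - \<phi> n x\<bar> \<le> M * sqrt (4 * inverse (real (Suc n)))" if "n \<le> k" for n k
    proof -
      let ?d = "\<lambda>x. \<phi> k x - \<phi> n x"
      \<comment> \<open>Differences of the sequence stay in \<open>Cc\<close>, so \<open>C\<close>
        bounds them at \<open>z\<close> by the energy alone, and \<open>K\<close> carries the bound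
        to \<open>x\<close>.\<close>
      have "?d \<in> Cc" using Cc_add[OF \<phi> Cc_cmult[OF \<phi>, of "-1"], of k n] by simp
      then have "\<bar>?d x\<bar> \<le> (K + C) * sqrt (Q ?d)"
        using C[of ?d] K(2)[of ?d] Cc_subset_FE unfolding distrib_right by fastforce
      also have "\<dots> \<le> M * sqrt (Q ?d)"
        unfolding M_def by (intro mult_right_mono) (auto simp: Q_nonneg)
      also have "\<dots> \<le> M * sqrt (4 * inverse (real (Suc n)))"
        using diff[OF that] by (intro mult_left_mono) (auto simp: M_def)
      finally show ?thesis .
    qed
    have lim: "(\<lambda>n. M * sqrt (4 * inverse (real (Suc n)))) \<longlonglongrightarrow> 0"
      using tendsto_real_sqrt[OF small[of 1]] by (auto intro: tendsto_mult_right_zero)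
    show ?thesis
    proof (rule CauchyI')
      fix e :: real
      assume "0 < e"
      with lim have "\<forall>\<^sub>F n in sequentially. M * sqrt (4 * inverse (real (Suc n))) < e"
        by (rule order_tendstoD)
      then obtain N where N: "\<And>n. N \<le> n \<Longrightarrow> M * sqrt (4 * inverse (real (Suc n))) < e"
        by (auto simp: eventually_sequentially)
      show "\<exists>N. \<forall>n\<ge>N. \<forall>k>n. dist (\<phi> n x) (\<phi> k x) < e"
      proof (intro exI[of _ N] allI impI)
        fix n k
        assume "N \<le> n" "n < k"
        then show "dist (\<phi> n x) (\<phi> k x) < e"
          using bound[of n k] N[of n] by (simp add: dist_real_def abs_minus_commute)
      qed
    qed
  qed
  then have "\<exists>L. (\<lambda>n. \<phi> n x) \<longlonglongrightarrow> L" for x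
    by (simp add: Cauchy_convergent_iff convergent_def)
  then obtain g where g: "\<And>x. (\<lambda>n. \<phi> n x) \<longlonglongrightarrow> g x"
    by metis
  \<comment> \<open>Lets \<open>k\<close> tend to infinity in \<open>diff\<close> for fixed
    \<open>n\<close>, by lower semicontinuity; pointwise convergence is thereby upgraded to
    convergence in energy.\<close>
  have g\<phi>: "(\<lambda>x. g x - \<phi> n x) \<in> FE" "Q (\<lambda>x. g x - \<phi> n x) \<le> 4 * inverse (real (Suc n))" for n
  proof -
    have l: "(\<lambda>k. \<phi> k x - \<phi> n x) \<longlonglongrightarrow> g x - \<phi> n x" for x
      by (intro tendsto_intros g)
    have "\<forall>\<^sub>F k in sequentially. (\<lambda>x. \<phi> k x - \<phi> n x) \<in> FE
        \<and> Q (\<lambda>x. \<phi> k x - \<phi> n x) \<le> 4 * inverse (real (Suc n))"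
      using eventually_ge_at_top[of n] by eventually_elim (simp add: FE_diff \<phi>_FE diff del: of_nat_Suc)
    from Fatou_Q[of "\<lambda>k x. \<phi> k x - \<phi> n x", OF l this] show "(\<lambda>x. g x - \<phi> n x) \<in> FE"
      "Q (\<lambda>x. g x - \<phi> n x) \<le> 4 * inverse (real (Suc n))" .
  qed
  have g_FE: "g \<in> FE"
    using FE_add[OF g\<phi>(1)[of 0] \<phi>_FE[of 0]] by simp
  have "g \<in> finite_energy0 b c z"
    unfolding finite_energy0_def
  proof (intro CollectI conjI allI impI g_FE)
    fix e :: real
    assume "0 < e"
    have "(\<lambda>n. sqrt (1 * (4 * inverse (real (Suc n))) + (g z - \<phi> n z)\<^sup>2)) \<longlonglongrightarrow> sqrt (0 + (g z - g z)\<^sup>2)"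
      by (intro tendsto_intros g small)
    then have "(\<lambda>n. sqrt (4 * inverse (real (Suc n)) + (g z - \<phi> n z)\<^sup>2)) \<longlonglongrightarrow> 0"
      by simp
    from order_tendstoD(2)[OF this \<open>0 < e\<close>]
    obtain n where n: "sqrt (4 * inverse (real (Suc n)) + (g z - \<phi> n z)\<^sup>2) < e"
      by (metis (no_types, lifting) eventually_sequentially order_refl)
    have "energy_norm b c z (\<lambda>x. g x - \<phi> n x) \<le> sqrt (4 * inverse (real (Suc n)) + (g z - \<phi> n z)\<^sup>2)"
      unfolding energy_norm_eq[OF g\<phi>(1)] using g\<phi>(2)[of n] by simp
    with n \<phi>[of n] show "\<exists>\<phi>\<in>Cc. energy_norm b c z (\<lambda>x. g x - \<phi> x) < e"
      by (meson le_less_trans)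
  qed
  moreover
  let ?h = "\<lambda>x. f x - g x"
  have h_FE: "?h \<in> FE" by (rule FE_diff[OF f g_FE])
  \<comment> \<open>Lower semicontinuity along the minimising sequence. With the lower bound
    \<open>m\<close> for all perturbations of \<open>?h\<close> by \<open>Cc\<close>, proved next,
    \<open>?h\<close> is minimal.\<close>
  have Qh: "Q ?h \<le> m"
  proof (rule field_le_epsilon)
    fix e :: real
    assume "0 < e"
    have "\<forall>\<^sub>F n in sequentially. inverse (real (Suc n)) < e"
      by (rule order_tendstoD(2)[OF LIMSEQ_inverse_real_of_nat \<open>0 < e\<close>])
    then have "\<forall>\<^sub>F n in sequentially. (\<lambda>x. f x - \<phi> n x) \<in> FE \<and> Q (\<lambda>x. f x - \<phi> n x) \<le> m + e"
    proof eventually_elim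
      case (elim n)
      then show ?case using f\<phi>_FE[of n] Q\<phi>[of n] by linarith
    qed
    moreover have "(\<lambda>n. f x - \<phi> n x) \<longlonglongrightarrow> f x - g x" for x
      by (intro tendsto_intros g)
    ultimately show "Q ?h \<le> m + e"
      by (intro Fatou_Q(2)[of "\<lambda>n x. f x - \<phi> n x"])
  qed
  \<comment> \<open>As \<open>g\<close> need not lie in \<open>Cc\<close>, \<open>m_le\<close>
    cannot be applied directly. Instead \<open>g\<close> is replaced by \<open>\<phi> n\<close> and
    the error absorbed by \<open>Q_add_le\<close>: first \<open>n\<close> tends to infinity, then
    \<open>e\<close> to 0.\<close>
  have "m \<le> Q (\<lambda>x. ?h x + \<psi> x)" if "\<psi> \<in> Cc" for \<psi>
  proof -
    let ?u = "\<lambda>x. ?h x + \<psi> x"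
    have u: "?u \<in> FE" using h_FE that Cc_subset_FE by (intro FE_add) auto
    have step: "m \<le> (1 + e) * Q ?u" if "0 < e" for e
    proof (rule LIMSEQ_le_const)
      show "(\<lambda>n. (1 + e) * Q ?u + (1 + 1 / e) * (4 * inverse (real (Suc n)))) \<longlonglongrightarrow> (1 + e) * Q ?u"
        using tendsto_add[OF tendsto_const small] by simp
      have "m \<le> (1 + e) * Q ?u + (1 + 1 / e) * (4 * inverse (real (Suc n)))" for n
      proof -
        have "m \<le> Q (\<lambda>x. f x - (\<phi> n x + (-1) * \<psi> x))"
          by (intro m_le Cc_add Cc_cmult \<phi> \<open>\<psi> \<in> Cc\<close>)
        also have "\<dots> = Q (\<lambda>x. ?u x + (g x - \<phi> n x))"
          by (simp add: algebra_simps)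
        also have "\<dots> \<le> (1 + e) * Q ?u + (1 + 1 / e) * Q (\<lambda>x. g x - \<phi> n x)"
          by (rule Q_add_le[OF u g\<phi>(1) \<open>0 < e\<close>])
        also have "\<dots> \<le> (1 + e) * Q ?u + (1 + 1 / e) * (4 * inverse (real (Suc n)))"
          using \<open>0 < e\<close> by (intro add_left_mono mult_left_mono g\<phi>(2)) auto
        finally show ?thesis .
      qed
      then show "\<exists>N. \<forall>n\<ge>N. m \<le> (1 + e) * Q ?u + (1 + 1 / e) * (4 * inverse (real (Suc n)))"
        by blast
    qed
    show ?thesis
    proof (rule field_le_epsilon)
      fix d :: real
      assume "0 < d"
      have pos: "0 < Q ?u + 1" using Q_nonneg[of ?u] by linarith
      \<comment> \<open>Takes \<open>e = d / (Q ?u + 1)\<close>; the added 1 keeps the denominator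
        positive even if \<open>Q ?u = 0\<close>.\<close>
      have "m \<le> Q ?u + d * (Q ?u / (Q ?u + 1))"
        using step[of "d / (Q ?u + 1)"] \<open>0 < d\<close> pos by (simp add: distrib_right)
      also have "\<dots> \<le> Q ?u + d * 1"
        using \<open>0 < d\<close> pos by (intro add_left_mono mult_left_mono) auto
      finally show "m \<le> Q ?u + d" by simp
    qed
  qed
  then have "graph_harmonic b c ?h"
    using Qh by (intro harmonic_if_minimal[OF h_FE]) (meson order_trans)
  ultimately show ?thesis using that h_FE by blast
qed

end

section \<open>Assembling the equivalence from the two implications\<close>

theorem theorem6p1:
  fixes b :: "'a \<Rightarrow> 'a \<Rightarrow> real" and c :: "'a \<Rightarrow> real" and z :: 'a
  assumes "countable (UNIV :: 'a set)" and "infinite (UNIV :: 'a set)"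
    and "weighted_graph b c" and "connected_graph b"
  shows "canonically_compactifiable b c \<longleftrightarrow>
    uniformly_transient b c z \<and>
    (\<forall>f. graph_harmonic b c f \<and> f \<in> finite_energy b c \<longrightarrow> f \<in> linfty)"
proof -
  interpret connected_weighted b c
    by unfold_locales (use assms in auto)
  show ?thesis
  proof (intro iffI conjI allI impI; (elim conjE)?)
    assume "canonically_compactifiable b c"
    then show "uniformly_transient b c z"
      by (rule uniformly_transient_if_canonically_compactifiable)
  next
    fix f
    assume "canonically_compactifiable b c" "f \<in> FE"
    then show "f \<in> linfty"
      by (auto simp: canonically_compactifiable_def)
  next
    assume ut: "uniformly_transient b c z"
      and harm: "\<forall>f. graph_harmonic b c f \<and> f \<in> FE \<longrightarrow> f \<in> linfty"
    \<comment> \<open>Infinitude of the vertex set enters here; the constant is the hypothesis of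
      \<open>Royden_decomposition\<close>.\<close>
    obtain C where C: "\<And>\<phi>. \<phi> \<in> Cc \<Longrightarrow> \<bar>\<phi> z\<bar> \<le> C * sqrt (Q \<phi>)"
      using Cc_le_sqrt_Q[OF ut assms(2)] by blast
    show "canonically_compactifiable b c"
      unfolding canonically_compactifiable_def
    proof
      fix f
      assume "f \<in> FE"
      then obtain g where g: "g \<in> finite_energy0 b c z"
        "graph_harmonic b c (\<lambda>x. f x - g x)" "(\<lambda>x. f x - g x) \<in> FE"
        using Royden_decomposition[OF _ C] by blast
      then have "g \<in> linfty" "(\<lambda>x. f x - g x) \<in> linfty"
        using ut harm C0_subset_linfty by (auto simp: uniformly_transient_def)
      from linfty_add[OF this] show "f \<in> linfty" by simp
    qed
  qed
qed

end
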